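(* Let $p>2$ be a prime, let $t$ be a positive divisor of $p-1$, let $k>1$ be an integer, let $s\in\mathbb{N}$ and let $a\in\mathbb{F}_p^*$. Put $r=r_2(k)=\left\lfloor\frac{\log(p/2)}{8\log k}-\frac14\right\rfloor$. Then $$\#V(k,t,a)\le\max\left(2\tilde\Phi(k^2,s-1),\ \binom{r+s}{s}^{-1}t\right).$$
   Context: $\mathbb{F}_p$ is the field of residues modulo $p$. For $x\in\mathbb{F}_p$, the rational height is $\|x\|=\min\{\max(|a|,b)~:~a\in\mathbb{Z},\ b\in\mathbb{N},\ a\equiv bx \pmod p\}$. For $t\mid p-1$, $G$ is the unique subgroup of $\mathbb{F}_p^*$ of order $t$, $aG=\{ag:g\in G\}$, and $V(k,t,a)=\{x\in aG~:~\|x\|\le k\}$. $\Psi(x,y)$ is the number of positive integers $n\le x$ all of whose prime factors are at most $y$; $p_j$ is the $j$-th prime ($p_1=2$), with the convention $\Psi(x,p_0)=1$ for $x\ge 1$. For $m\in\mathbb{N}$, $\tilde\Phi(x,m)=\sum_{i=0}^{m}\binom{m}{i}\Psi(x,p_i)\Psi(x,p_{m-i})$, and $\tilde\Phi(x,0)=1$. *)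

theory Defs
  imports
    "HOL-Number_Theory.Residues"
    "HOL-Library.Infinite_Set"
    "HOL-Library.Extended_Real"
begin

text \<open>
  The field of residues modulo \<open>p\<close> is \<open>residue_ring (int p)\<close>, with carrier \<open>{0..p-1}\<close>;
  its multiplicative group is \<open>mult_of (residue_ring (int p))\<close>.
\<close>

abbreviation Fp_star :: "nat \<Rightarrow> int monoid" where
  "Fp_star p \<equiv> mult_of (residue_ring (int p))"

text \<open>The denominator \<open>b\<close> ranges over the positive integers; \<open>b = 0\<close> would give height 0 always.\<close>

definition rational_height :: "nat \<Rightarrow> int \<Rightarrow> nat" where
  "rational_height p x =
     (LEAST h. \<exists>(a::int) (b::nat). b \<ge> 1 \<and> [a = int b * x] (mod int p) \<and> h = max (nat \<bar>a\<bar>) b)"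

definition subgroup_of_order :: "nat \<Rightarrow> nat \<Rightarrow> int set" where
  "subgroup_of_order p t = (THE G. subgroup G (Fp_star p) \<and> card G = t)"

lemma ex1_subgroup_of_order:
  assumes "prime p" "t dvd p - 1" "t > 0"
  shows "\<exists>!G. subgroup G (Fp_star p) \<and> card G = t"
proof -
  let ?R = "residue_ring (int p)"
  have p: "p > 1" using assms(1) prime_gt_1_nat by blast
  have "residues_prime p" using assms(1) by unfold_locales simp_all
  then interpret F: Ring.field ?R by (rule residues_prime.is_field)
  interpret M: Group.group "mult_of ?R" by (rule F.field_mult_group)
  have finR: "finite (carrier ?R)" by (simp add: residue_ring_def)
  have fin: "finite (carrier (mult_of ?R))" using finR by simp
  have "order ?R = p" by (simp add: order_def residue_ring_def)
  then have ordM: "order (mult_of ?R) = p - 1" using F.order_mult_of[OF finR] by simp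
  have uniq: "H = {x \<in> carrier ?R. x [^]\<^bsub>?R\<^esub> t = \<one>\<^bsub>?R\<^esub>}"
    if H: "subgroup H (mult_of ?R)" "card H = t" for H
  proof (rule card_seteq)
    show "finite {x \<in> carrier ?R. x [^]\<^bsub>?R\<^esub> t = \<one>\<^bsub>?R\<^esub>}" using finR by simp
    show "card {x \<in> carrier ?R. x [^]\<^bsub>?R\<^esub> t = \<one>\<^bsub>?R\<^esub>} \<le> card H"
      using F.num_roots_le_deg[OF finR, of t] assms(3) H(2) by simp
    show "H \<subseteq> {x \<in> carrier ?R. x [^]\<^bsub>?R\<^esub> t = \<one>\<^bsub>?R\<^esub>}"
    proof
      fix x assume x: "x \<in> H"
      interpret S: Group.group "(mult_of ?R)\<lparr>carrier := H\<rparr>"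
        by (rule M.subgroup_imp_group[OF H(1)])
      have "x [^]\<^bsub>(mult_of ?R)\<lparr>carrier := H\<rparr>\<^esub> card H = \<one>\<^bsub>?R\<^esub>"
        using S.pow_order_eq_1[of x] x by (simp add: order_def)
      then have "x [^]\<^bsub>mult_of ?R\<^esub> t = \<one>\<^bsub>?R\<^esub>"
        by (simp only: H(2) M.nat_pow_consistent[symmetric])
      moreover have "x \<in> carrier (mult_of ?R)" using subgroup.subset[OF H(1)] x by blast
      ultimately show "x \<in> {x \<in> carrier ?R. x [^]\<^bsub>?R\<^esub> t = \<one>\<^bsub>?R\<^esub>}"
        by (simp add: nat_pow_mult_of)
    qed
  qed
  obtain g where g: "g \<in> carrier (mult_of ?R)"
      "carrier (mult_of ?R) = {g [^]\<^bsub>?R\<^esub> i | i::nat. i \<in> UNIV}"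
    using F.finite_field_mult_group_has_gen[OF finR] by blast
  have "generate (mult_of ?R) {g} = carrier (mult_of ?R)"
    using M.generate_pow_on_finite_carrier[OF fin g(1)] g(2) by (simp add: nat_pow_mult_of)
  then have ordg: "M.ord g = p - 1"
    using M.generate_pow_card[OF g(1)] ordM by (simp add: order_def)
  obtain d where d: "p - 1 = t * d" using assms(2) by blast
  then have d0: "d > 0" using p by (cases d) auto
  let ?h = "g [^]\<^bsub>mult_of ?R\<^esub> d"
  have h: "?h \<in> carrier (mult_of ?R)" using g(1) by (rule M.nat_pow_closed)
  have "M.ord ?h = t" using M.ord_pow_gen[OF g(1), of d] d0 d ordg by simp
  then have "card (generate (mult_of ?R) {?h}) = t" using M.generate_pow_card[OF h] by simp
  moreover have "subgroup (generate (mult_of ?R) {?h}) (mult_of ?R)"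
    using M.generate_is_subgroup h by blast
  ultimately show ?thesis
    by (intro ex1I[of _ "generate (mult_of ?R) {?h}"]) (blast, use uniq in blast)
qed

definition V :: "nat \<Rightarrow> nat \<Rightarrow> nat \<Rightarrow> int \<Rightarrow> int set" where
  "V p k t a = {x \<in> a <#\<^bsub>Fp_star p\<^esub> subgroup_of_order p t. rational_height p x \<le> k}"

definition Psi :: "real \<Rightarrow> real \<Rightarrow> nat" where
  "Psi x y = card {n::nat. n > 0 \<and> real n \<le> x \<and> (\<forall>q\<in>prime_factors n. real q \<le> y)}"

text \<open>\<open>enumerate\<close> counts from 0, so the \<open>j\<close>-th prime \<open>p\<^sub>j\<close> (with \<open>p\<^sub>1 = 2\<close>) has index \<open>j - 1\<close>.\<close>

definition nth_prime :: "nat \<Rightarrow> nat" where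
  "nth_prime j = enumerate {q. prime q} (j - 1)"

text \<open>\<open>\<Psi>(x, p\<^sub>j)\<close>, including the convention \<open>\<Psi>(x, p\<^sub>0) = 1\<close>.\<close>

definition Psi_prime :: "real \<Rightarrow> nat \<Rightarrow> nat" where
  "Psi_prime x j = (if j = 0 then 1 else Psi x (real (nth_prime j)))"

definition Phi_tilde :: "real \<Rightarrow> nat \<Rightarrow> nat" where
  "Phi_tilde x m = (\<Sum>i=0..m. (m choose i) * Psi_prime x i * Psi_prime x (m - i))"

lemma Phi_tilde_0: "Phi_tilde x 0 = 1"
  by (simp add: Phi_tilde_def Psi_prime_def)

definition r2 :: "nat \<Rightarrow> nat \<Rightarrow> int" where
  "r2 p k = \<lfloor>ln (real p / 2) / (8 * ln (real k)) - 1 / 4\<rfloor>"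

text \<open>
  \<open>r2 p k\<close> equals \<open>-1\<close> when \<open>k\<^sup>2 > p / 2\<close>. Then the binomial coefficient of \<open>r + s\<close> over \<open>s\<close>
  vanishes for \<open>s \<ge> 1\<close>, so its reciprocal has to be read as \<open>\<infinity>\<close> (and not as 0, as in \<open>real\<close>);
  this is the value of \<open>inverse\<close> on \<open>ereal\<close>.
\<close>

definition inverse_binomial :: "int \<Rightarrow> nat \<Rightarrow> ereal" where
  "inverse_binomial r s = inverse (ereal (of_int (r + int s) gchoose s))"

end

theory Submission
  imports Defs
begin

text \<open>
  Represent each \<open>x \<in> V\<close> by a fraction \<open>u/v\<close> with \<open>\<bar>u\<bar>, v \<le> k\<close>, let \<open>w x\<close> be its vector of prime
  exponents, and let \<open>D\<close> be the set of all differences \<open>w x - w x'\<close>. Choose greedily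
  \<open>y\<^sub>0, y\<^sub>1, \<dots> \<in> D\<close> and primes \<open>q\<^sub>0, q\<^sub>1, \<dots>\<close> such that \<open>y\<^sub>j\<close> maximises \<open>\<bar>d q\<^sub>j\<bar> > 0\<close> among
  the \<open>d \<in> D\<close> vanishing at \<open>q\<^sub>0, \<dots>, q\<^sub>j\<^sub>-\<^sub>1\<close>.

  If this stops before step \<open>s\<close>, then at most \<open>s - 1\<close> primes separate the vectors \<open>w x\<close>. Up to
  sign, \<open>x\<close> is then determined by the part supported on these primes of the quotient of its
  fraction by a fixed one, which has numerator and denominator at most \<open>k\<^sup>2\<close>; sorting by the set
  of primes with positive exponent gives the bound with \<open>Phi_tilde\<close>.

  Otherwise no nontrivial combination \<open>\<Sum> 2 c\<^sub>i y\<^sub>i\<close> lies in \<open>D\<close>: at the first \<open>j\<close> with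
  \<open>c\<^sub>j \<noteq> 0\<close> it would beat the maximality of \<open>y\<^sub>j\<close>. So the translates of \<open>V\<close> by
  \<open>\<Sum> 2 e\<^sub>i y\<^sub>i\<close> with \<open>e\<^sub>i \<ge> 0\<close> and \<open>\<Sum> e\<^sub>i \<le> r\<close> are disjoint. Their members are fractions of height at
  most \<open>k\<close> to the power \<open>4r + 1\<close>, hence distinct modulo \<open>p\<close>, and they lie in the coset of size \<open>t\<close>.
\<close>

section \<open>Greedy choice of difference vectors and coordinates\<close>

text \<open>Induction on \<open>m\<close>: either the coordinates chosen so far already detect every
  nonzero member of \<open>D\<close>, or a member vanishing on all of them survives and extends the
  flag. Asking that each \<open>q\<close> in \<open>Q\<close> be a nonzero coordinate of some
  \<open>d\<close> later forces \<open>Q\<close> to consist of primes.\<close>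

lemma greedy_flag:
  fixes D :: "('b \<Rightarrow> int) set"
  assumes "finite D"
  shows "(\<exists>Q. finite Q \<and> card Q < m \<and> (\<forall>q\<in>Q. \<exists>d\<in>D. d q \<noteq> 0) \<and>
            (\<forall>d\<in>D. (\<forall>q\<in>Q. d q = 0) \<longrightarrow> (\<forall>q. d q = 0))) \<or>
         (\<exists>y q. \<forall>j<m. y j \<in> D \<and> y j (q j) \<noteq> 0 \<and> (\<forall>i<j. y j (q i) = 0) \<and>
            (\<forall>d\<in>D. (\<forall>i<j. d (q i) = 0) \<longrightarrow> \<bar>d (q j)\<bar> \<le> \<bar>y j (q j)\<bar>))"
proof (induction m)
  case 0
  show ?case by simp
next
  case (Suc m)
  then show ?case
  proof (elim disjE exE, goal_cases)
    case (1 Q)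
    then have "card Q < Suc m" by simp
    with 1 show ?case by blast
  next
    case (2 y q)
    let ?Q = "q ` {..<m}"
    show ?case
    proof (cases "\<forall>d\<in>D. (\<forall>i\<in>?Q. d i = 0) \<longrightarrow> (\<forall>q. d q = 0)")
      case True
      have "card ?Q < Suc m" using card_image_le[of "{..<m}" q] by simp
      moreover have "\<forall>x\<in>?Q. \<exists>d\<in>D. d x \<noteq> 0" using 2 by blast
      moreover have "finite ?Q" by simp
      ultimately show ?thesis using True by blast
    next
      case False
      \<comment> \<open>Any coordinate \<open>x\<close> at which the surviving \<open>d\<close> is
        nonzero can serve as \<open>q m\<close>; finiteness of \<open>D\<close> supplies the
        maximiser \<open>e\<close>.\<close>
      then obtain d x where d: "d \<in> D" "\<forall>i<m. d (q i) = 0" "d x \<noteq> 0" by auto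
      let ?D = "{d \<in> D. \<forall>i<m. d (q i) = 0}"
      have fin: "finite ((\<lambda>d. \<bar>d x\<bar>) ` ?D)" and ne: "(\<lambda>d. \<bar>d x\<bar>) ` ?D \<noteq> {}"
        using assms d by auto
      obtain e where e: "e \<in> ?D" "\<bar>e x\<bar> = Max ((\<lambda>d. \<bar>d x\<bar>) ` ?D)"
        using Max_in[OF fin ne] by auto
      have max: "\<bar>d' x\<bar> \<le> \<bar>e x\<bar>" if "d' \<in> ?D" for d'
        using Max_ge[OF fin, of "\<bar>d' x\<bar>"] that e(2) by simp
      have "e x \<noteq> 0" using max[of d] d by auto
      define y' q' where "y' = y(m := e)" and "q' = q(m := x)"
      have old: "y' j = y j" "q' j = q j" if "j < m" for j
        using that by (simp_all add: y'_def q'_def)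
      have new: "y' m = e" "q' m = x" by (simp_all add: y'_def q'_def)
      have "y' j \<in> D \<and> y' j (q' j) \<noteq> 0 \<and> (\<forall>i<j. y' j (q' i) = 0) \<and>
          (\<forall>d\<in>D. (\<forall>i<j. d (q' i) = 0) \<longrightarrow> \<bar>d (q' j)\<bar> \<le> \<bar>y' j (q' j)\<bar>)" if "j < Suc m" for j
      proof (cases "j = m")
        case True
        then show ?thesis using e(1) max \<open>e x \<noteq> 0\<close> by (simp add: new old)
      next
        case False
        then have "j < m" using that by simp
        moreover have "q' i = q i" if "i < j" for i using that \<open>j < m\<close> by (simp add: old)
        ultimately show ?thesis using 2[rule_format, OF \<open>j < m\<close>] by (simp add: old)
      qed
      then show ?thesis by (intro disjI2 exI[of _ y'] exI[of _ q'] allI impI)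
    qed
  qed
qed

text \<open>The values \<open>y n (q l)\<close> form a triangular array, so at the first
  \<open>j\<close> with \<open>c j \<noteq> 0\<close> a single term remains:
  \<open>z (q j) = 2 * c j * y j (q j)\<close>. The factor 2 makes this exceed the maximum strictly,
  even when \<open>\<bar>c j\<bar> = 1\<close>.\<close>

lemma greedy_flag_doubled_combination:
  fixes D :: "('b \<Rightarrow> int) set" and m :: nat
  assumes flag: "\<forall>j<m. y j \<in> D \<and> y j (q j) \<noteq> 0 \<and> (\<forall>i<j. y j (q i) = 0) \<and>
            (\<forall>d\<in>D. (\<forall>i<j. d (q i) = 0) \<longrightarrow> \<bar>d (q j)\<bar> \<le> \<bar>y j (q j)\<bar>)"
    and z: "z \<in> D" "\<And>x. (\<exists>i<m. x = q i) \<Longrightarrow> z x = (\<Sum>i<m. 2 * c i * y i x)"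
    and i: "i < m"
  shows "c i = 0"
proof (rule ccontr)
  assume "c i \<noteq> 0"
  define j where "j = (LEAST i. i < m \<and> c i \<noteq> 0)"
  have j: "j < m" "c j \<noteq> 0"
    using LeastI[of "\<lambda>i. i < m \<and> c i \<noteq> 0" i] i \<open>c i \<noteq> 0\<close> by (auto simp: j_def)
  have less: "c l = 0" if "l < j" for l
    using not_less_Least[of l "\<lambda>i. i < m \<and> c i \<noteq> 0"] that j(1) by (auto simp: j_def)
  have y_zero: "y n (q l) = 0" if "l < n" "n < m" for l n using flag that by blast
  have y_nz: "y j (q j) \<noteq> 0" using flag j(1) by blast
  have "z (q l) = 0" if l: "l < j" for l
  proof -
    have "c n * y n (q l) = 0" if "n < m" for n
      using y_zero[of l n] that l less[of n] by (cases "n < j") simp_all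
    then have "(\<Sum>n<m. 2 * c n * y n (q l)) = 0" by (intro sum.neutral) auto
    moreover have "\<exists>i<m. q l = q i" using l j(1) less_trans by blast
    ultimately show ?thesis using z(2)[of "q l"] by simp
  qed
  then have le: "\<bar>z (q j)\<bar> \<le> \<bar>y j (q j)\<bar>" using flag j(1) z(1) by blast
  have "c n * y n (q j) = 0" if "n < m" "n \<noteq> j" for n
    using y_zero[of j n] that less[of n] by (cases "n < j") simp_all
  then have "(\<Sum>n<m. 2 * c n * y n (q j)) = (\<Sum>n\<in>{j}. 2 * c n * y n (q j))"
    using j(1) by (intro sum.mono_neutral_right) (auto simp: mult.assoc)
  then have "\<bar>z (q j)\<bar> = 2 * \<bar>c j\<bar> * \<bar>y j (q j)\<bar>" using z(2)[of "q j", OF exI[of _ j]] j(1)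
    by (simp add: abs_mult)
  moreover have "1 \<le> \<bar>c j\<bar>" "0 < \<bar>y j (q j)\<bar>" using j(2) y_nz by auto
  then have "1 * \<bar>y j (q j)\<bar> \<le> \<bar>c j\<bar> * \<bar>y j (q j)\<bar>" by (intro mult_right_mono) auto
  ultimately show False using le \<open>0 < \<bar>y j (q j)\<bar>\<close> by linarith
qed

section \<open>Counting smooth numbers over a finite set of primes\<close>

lemma sum_Pow_card:
  fixes f :: "nat \<Rightarrow> nat"
  assumes "finite Q"
  shows "(\<Sum>I\<in>Pow Q. f (card I)) = (\<Sum>i=0..card Q. (card Q choose i) * f i)"
proof -
  have "(\<Sum>I\<in>Pow Q. f (card I)) =
      (\<Sum>i=0..card Q. \<Sum>I\<in>{I \<in> Pow Q. card I = i}. f (card I))"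
    using assms by (intro sum.group[symmetric]) (auto intro: card_mono)
  also have "\<dots> = (\<Sum>i=0..card Q. (card Q choose i) * f i)"
    using assms by (intro sum.cong) (simp_all add: n_subsets)
  finally show ?thesis .
qed

lemma prod_prime_power_dvd:
  fixes N :: "'b :: factorial_semiring_gcd"
  assumes "finite Q" "\<And>q. q \<in> Q \<Longrightarrow> prime q" "\<And>q. q \<in> Q \<Longrightarrow> q ^ f q dvd N"
  shows "(\<Prod>q\<in>Q. q ^ f q) dvd N"
  using assms
proof (induction Q rule: finite_induct)
  case (insert q Q)
  have "coprime (q ^ f q) (\<Prod>q\<in>Q. q ^ f q)"
    using insert
    by (intro prod_coprime_right)
       (auto simp: coprime_power_left_iff coprime_power_right_iff intro!: primes_coprime)
  then show ?case using insert by (simp add: divides_mult)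
qed simp

text \<open>\<open>Psi\<close> admits all primes up to a bound, whereas the primes separating
  exponent vectors form an arbitrary finite set; this is the analogue of \<open>Psi\<close> for such
  a set.\<close>

definition smooth_over :: "nat \<Rightarrow> nat set \<Rightarrow> nat set" where
  "smooth_over B I = {n. 0 < n \<and> n \<le> B \<and> prime_factors n \<subseteq> I}"

lemma finite_smooth_over [simp]: "finite (smooth_over B I)"
  by (rule finite_subset[of _ "{..B}"]) (auto simp: smooth_over_def)

lemma prod_multiplicity_smooth_over:
  assumes "n \<in> smooth_over B I" "finite I" "\<And>q. q \<in> I \<Longrightarrow> prime q"
  shows "(\<Prod>q\<in>I. q ^ multiplicity q n) = n"
proof -
  have "n = (\<Prod>q\<in>prime_factors n. q ^ multiplicity q n)"
    using assms(1) by (simp add: smooth_over_def prod_prime_factors)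
  also have "\<dots> = (\<Prod>q\<in>I. q ^ multiplicity q n)"
    using assms by (intro prod.mono_neutral_left)
      (auto simp: smooth_over_def prime_factors_multiplicity)
  finally show ?thesis by simp
qed

text \<open>Replacing the \<open>i\<close>-th smallest prime of \<open>I\<close> by the \<open>i\<close>-th prime decreases every number.\<close>

lemma card_smooth_over_le_Psi_prime:
  assumes I: "finite I" "\<And>q. q \<in> I \<Longrightarrow> prime q"
  shows "card (smooth_over B I) \<le> Psi_prime (real B) (card I)"
proof (cases "I = {}")
  case True
  have "smooth_over B I \<subseteq> {1}"
    using True by (auto simp: smooth_over_def prime_factorization_empty_iff)
  then have "card (smooth_over B I) \<le> card {1::nat}" by (rule card_mono[rotated]) simp
  then show ?thesis using True by (simp add: Psi_prime_def)
next
  case False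
  let ?P = "{q::nat. prime q}"
  have inf: "infinite ?P" by (rule primes_infinite)
  \<comment> \<open>\<open>c q\<close> is the rank of \<open>q\<close> in \<open>I\<close>, counted
    from 0 to match \<open>enumerate\<close>; hence \<open>h\<close> maps \<open>I\<close>
    increasingly onto the first \<open>card I\<close> primes.\<close>
  define c where "c q = card {q' \<in> I. q' < q}" for q
  define h where "h q = enumerate ?P (c q)" for q
  have c_less: "c q < c q'" if "q \<in> I" "q' \<in> I" "q < q'" for q q'
    unfolding c_def using I(1) that by (intro psubset_card_mono) auto
  have c_card: "c q < card I" if "q \<in> I" for q
    unfolding c_def using I(1) that by (intro psubset_card_mono) auto
  have inj_h: "inj_on h I"
  proof (rule inj_onI)
    fix q q' assume "q \<in> I" "q' \<in> I" "h q = h q'"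
    moreover from this have "c q = c q'"
      using inj_enumerate[OF inf] by (auto simp: h_def dest: injD)
    ultimately show "q = q'" using c_less[of q q'] c_less[of q' q] by (cases q q' rule: linorder_cases) auto
  qed
  have h_prime: "prime (h q)" for q using enumerate_in_set[OF inf] by (simp add: h_def)
  \<comment> \<open>If \<open>q\<close> is the prime of index \<open>n\<close>, the
    \<open>c q\<close> smaller members of \<open>I\<close> are among the \<open>n\<close> smaller
    primes, so \<open>c q \<le> n\<close>.\<close>
  have h_le: "h q \<le> q" if q: "q \<in> I" for q
  proof -
    obtain n where n: "enumerate ?P n = q" using enumerate_Ex[of ?P q] inf I(2)[OF q] by auto
    have "{q' \<in> I. q' < q} \<subseteq> enumerate ?P ` {..<n}"
    proof
      fix q' assume q': "q' \<in> {q' \<in> I. q' < q}"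
      then obtain n' where n': "enumerate ?P n' = q'"
        using enumerate_Ex[of ?P q'] inf I(2) by auto
      then have "n' < n" using q' n inf enumerate_mono_iff[of ?P n' n] by auto
      then show "q' \<in> enumerate ?P ` {..<n}" using n' by auto
    qed
    then have "c q \<le> card (enumerate ?P ` {..<n})" unfolding c_def by (intro card_mono) auto
    also have "\<dots> \<le> n" using card_image_le[of "{..<n}"] by simp
    finally show ?thesis using n inf by (auto simp: h_def enumerate_mono_le_iff)
  qed
  \<comment> \<open>The largest rank is \<open>card I - 1\<close>, the very index that
    \<open>nth_prime (card I)\<close> passes to \<open>enumerate\<close>.\<close>
  have h_nth: "h q \<le> nth_prime (card I)" if "q \<in> I" for q
    using c_card[OF that] inf by (simp add: h_def nth_prime_def)
  define g where "g n = (\<Prod>q\<in>I. h q ^ multiplicity q n)" for n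
  \<comment> \<open>Since \<open>h\<close> is injective, no exponents merge, and \<open>g n\<close>
    determines all exponents of \<open>n\<close> at the primes of \<open>I\<close>.\<close>
  have mult_g: "multiplicity (h q) (g n) = multiplicity q n" if "q \<in> I" for q n
  proof -
    have "g n = (\<Prod>q\<in>h ` I. q ^ multiplicity (the_inv_into I h q) n)"
      unfolding g_def using inj_h by (simp add: prod.reindex the_inv_into_f_f)
    moreover have "multiplicity (h q) (\<Prod>q\<in>h ` I. q ^ multiplicity (the_inv_into I h q) n) =
        multiplicity (the_inv_into I h (h q)) n"
      using that I(1) h_prime by (subst multiplicity_prod_prime_powers) auto
    ultimately show ?thesis using that inj_h by (simp add: the_inv_into_f_f)
  qed
  let ?T = "{n::nat. n > 0 \<and> real n \<le> real B \<and> (\<forall>q\<in>prime_factors n. real q \<le> real (nth_prime (card I)))}"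
  have "card (smooth_over B I) \<le> card ?T"
  proof (rule card_inj_on_le[of g])
    show "inj_on g (smooth_over B I)"
    proof (rule inj_onI)
      fix m n assume mn: "m \<in> smooth_over B I" "n \<in> smooth_over B I" "g m = g n"
      then have "multiplicity q m = multiplicity q n" if "q \<in> I" for q
        using mult_g[OF that] by metis
      then have "(\<Prod>q\<in>I. q ^ multiplicity q m) = (\<Prod>q\<in>I. q ^ multiplicity q n)" by simp
      then show "m = n" using prod_multiplicity_smooth_over[OF _ I] mn by simp
    qed
    show "finite ?T" by (rule finite_subset[of _ "{..B}"]) auto
    show "g ` smooth_over B I \<subseteq> ?T"
    proof
      fix x assume "x \<in> g ` smooth_over B I"
      then obtain n where n: "n \<in> smooth_over B I" "x = g n" by auto
      have "g n \<le> (\<Prod>q\<in>I. q ^ multiplicity q n)"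
        unfolding g_def using h_le by (intro prod_mono) (auto intro: power_mono)
      then have "g n \<le> B" using prod_multiplicity_smooth_over[OF n(1) I] n(1)
        by (simp add: smooth_over_def)
      moreover have "g n > 0" unfolding g_def
        using h_prime by (intro prod_pos) (simp add: prime_gt_0_nat)
      moreover have "l \<le> nth_prime (card I)" if "l \<in> prime_factors (g n)" for l
      proof -
        have "prime l" "l dvd g n" using that by auto
        then obtain q where q: "q \<in> I" "l dvd h q ^ multiplicity q n"
          unfolding g_def using I(1) by (auto simp: prime_dvd_prod_iff)
        then have "l dvd h q" using \<open>prime l\<close> prime_dvd_power by blast
        then have "l = h q" using \<open>prime l\<close> h_prime primes_dvd_imp_eq by blast
        then show ?thesis using h_nth q by simp
      qed
      ultimately show "x \<in> ?T" using n(2) by auto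
    qed
  qed
  then show ?thesis using False I(1) by (simp add: Psi_prime_def Psi_def)
qed

section \<open>Exponent vectors of fractions and translates modulo \<open>p\<close>\<close>

text \<open>These are the signed valuations of \<open>u / v\<close>. The value 0 off the primes
  ensures that two such vectors can differ only at primes.\<close>

definition exponent_vector :: "int \<Rightarrow> int \<Rightarrow> nat \<Rightarrow> int" where
  "exponent_vector u v q =
     (if prime q then int (multiplicity (int q) u) - int (multiplicity (int q) v) else 0)"

lemma multiplicity_prod_power:
  fixes f :: "nat \<Rightarrow> int"
  assumes "prime q" and "x \<noteq> 0" "\<And>i. i < s \<Longrightarrow> f i \<noteq> 0"
  shows "multiplicity q (x * (\<Prod>i<s. f i ^ e i)) = multiplicity q x + (\<Sum>i<s. e i * multiplicity q (f i))"
proof -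
  have q: "prime_elem q" using assms(1) by (rule prime_imp_prime_elem)
  have "multiplicity q (\<Prod>i<s. f i ^ e i) = (\<Sum>i<s. multiplicity q (f i ^ e i))"
    using assms q by (intro prime_elem_multiplicity_prod_distrib) auto
  also have "\<dots> = (\<Sum>i<s. e i * multiplicity q (f i))"
    using assms q by (intro sum.cong) (auto simp: prime_elem_multiplicity_power_distrib)
  finally show ?thesis using assms q by (simp add: prime_elem_multiplicity_mult_distrib)
qed

text \<open>\<open>C\<close> models the coset \<open>aG\<close>: it is closed under
  \<open>x * y / z\<close> though in general not under products. \<open>X\<close> models the
  elements of height at most \<open>k\<close>, with a chosen fraction \<open>u x / v x\<close> for
  each; \<open>k < p\<close> makes the denominators invertible modulo \<open>p\<close>.\<close>

locale small_fractions =
  fixes p k :: nat and C X :: "int set" and u v :: "int \<Rightarrow> int"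
  assumes prime_p: "prime p"
    and odd_p: "odd p"
    and k_pos: "0 < k"
    and k_less: "k < p"
    and C: "C \<subseteq> {0<..<int p}"
    and C_quotient: "\<And>x y z. x \<in> C \<Longrightarrow> y \<in> C \<Longrightarrow> z \<in> C \<Longrightarrow> \<exists>c\<in>C. [c * z = x * y] (mod int p)"
    and X: "X \<subseteq> C"
    and u_cong: "\<And>x. x \<in> X \<Longrightarrow> [u x = v x * x] (mod int p)"
    and u_le: "\<And>x. x \<in> X \<Longrightarrow> \<bar>u x\<bar> \<le> int k"
    and v_pos: "\<And>x. x \<in> X \<Longrightarrow> 0 < v x"
    and v_le: "\<And>x. x \<in> X \<Longrightarrow> v x \<le> int k"
begin

abbreviation w :: "int \<Rightarrow> nat \<Rightarrow> int" where
  "w x \<equiv> exponent_vector (u x) (v x)"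

lemma finite_C: "finite C"
  using C by (rule finite_subset) simp

lemma finite_X: "finite X"
  using X finite_C by (rule finite_subset)

lemma C_eqI:
  assumes "x \<in> C" "y \<in> C" "[x = y] (mod int p)"
  shows "x = y"
  using assms C by (intro cong_less_imp_eq_int[of x "int p" y]) auto

lemma prime_int_p: "prime (int p)"
  using prime_p by simp

lemma coprime_v: "x \<in> X \<Longrightarrow> coprime (v x) (int p)"
  using v_pos[of x] v_le[of x] k_less prime_int_p
  by (metis coprime_commute prime_imp_coprime zdvd_not_zless of_nat_less_iff order_le_less_trans)

lemma coprime_u:
  assumes "x \<in> X"
  shows "coprime (u x) (int p)"
proof -
  have "0 < x" "x < int p" using assms C X by auto
  then have "coprime x (int p)"
    using prime_int_p by (metis coprime_commute prime_imp_coprime zdvd_not_zless)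
  then have "coprime (v x * x) (int p)" using coprime_v[OF assms] by simp
  then show ?thesis using u_cong[OF assms] cong_sym cong_imp_coprime by blast
qed

lemma u_nonzero: "x \<in> X \<Longrightarrow> u x \<noteq> 0"
  using coprime_u[of x] prime_int_p by auto

lemma eq_if_fractions_eq:
  assumes "x \<in> X" "y \<in> X" "u x * v y = u y * v x"
  shows "x = y"
proof -
  have "[(v x * x) * v y = u x * v y] (mod int p)"
    by (intro cong_mult cong_sym[OF u_cong[OF assms(1)]]) auto
  also have "[u x * v y = (v y * y) * v x] (mod int p)"
    unfolding assms(3) by (intro cong_mult u_cong assms) auto
  finally have "[(v x * v y) * x = (v x * v y) * y] (mod int p)" by (simp add: mult_ac)
  then have "[x = y] (mod int p)"
    using coprime_v assms by (simp add: cong_mult_lcancel)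
  then show ?thesis using C_eqI assms X by auto
qed

text \<open>\<open>N\<close> and \<open>M\<close> are numerator and denominator, deliberately not
  reduced, of the fraction of \<open>x\<close> times the product of
  \<open>(\<alpha> i / \<beta> i) ^ (2 * e i)\<close>, each \<alpha> and \<beta> being replaced by
  its fraction. In exponent vectors this is the translate of \<open>w x\<close> by the sum of
  \<open>2 * e i * (w (\<alpha> i) - w (\<beta> i))\<close>.\<close>

definition N :: "nat \<Rightarrow> (nat \<Rightarrow> int) \<Rightarrow> (nat \<Rightarrow> int) \<Rightarrow> int \<Rightarrow> (nat \<Rightarrow> nat) \<Rightarrow> int" where
  "N s \<alpha> \<beta> x e = u x * (\<Prod>i<s. (u (\<alpha> i) * v (\<beta> i)) ^ (2 * e i))"

definition M :: "nat \<Rightarrow> (nat \<Rightarrow> int) \<Rightarrow> (nat \<Rightarrow> int) \<Rightarrow> int \<Rightarrow> (nat \<Rightarrow> nat) \<Rightarrow> int" where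
  "M s \<alpha> \<beta> x e = v x * (\<Prod>i<s. (v (\<alpha> i) * u (\<beta> i)) ^ (2 * e i))"

text \<open>Each step replaces \<open>z\<close> by \<open>z * \<alpha> / \<beta>\<close>, which
  stays in \<open>C\<close> by the quotient closure. Denominators are cleared throughout, so no
  modular inverse appears.\<close>

lemma C_contains_power_quotient:
  assumes "\<alpha> \<in> X" "\<beta> \<in> X" "c \<in> C"
  shows "\<exists>z\<in>C. [(u \<alpha> * v \<beta>) ^ n * c = (v \<alpha> * u \<beta>) ^ n * z] (mod int p)"
proof (induction n)
  case 0
  then show ?case using assms by (auto intro!: bexI[of _ c])
next
  case (Suc n)
  then obtain z where z: "z \<in> C" "[(u \<alpha> * v \<beta>) ^ n * c = (v \<alpha> * u \<beta>) ^ n * z] (mod int p)"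
    by blast
  obtain z' where z': "z' \<in> C" "[z' * \<beta> = z * \<alpha>] (mod int p)"
    using C_quotient[of z \<alpha> \<beta>] z(1) assms X by blast
  have "[(u \<alpha> * v \<beta>) * ((u \<alpha> * v \<beta>) ^ n * c) = ((v \<alpha> * \<alpha>) * v \<beta>) * ((v \<alpha> * u \<beta>) ^ n * z)] (mod int p)"
    by (intro cong_mult z u_cong assms cong_refl)
  also have "((v \<alpha> * \<alpha>) * v \<beta>) * ((v \<alpha> * u \<beta>) ^ n * z) = (z * \<alpha>) * (v \<alpha> * v \<beta> * (v \<alpha> * u \<beta>) ^ n)"
    by (simp add: mult_ac)
  also have "[\<dots> = (z' * \<beta>) * (v \<alpha> * v \<beta> * (v \<alpha> * u \<beta>) ^ n)] (mod int p)"
    by (intro cong_mult cong_sym[OF z'(2)] cong_refl)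
  also have "(z' * \<beta>) * (v \<alpha> * v \<beta> * (v \<alpha> * u \<beta>) ^ n) = (v \<beta> * \<beta>) * (v \<alpha> * (v \<alpha> * u \<beta>) ^ n * z')"
    by (simp add: mult_ac)
  also have "[\<dots> = u \<beta> * (v \<alpha> * (v \<alpha> * u \<beta>) ^ n * z')] (mod int p)"
    by (intro cong_mult cong_sym[OF u_cong] assms cong_refl)
  finally show ?case using z'(1) by (auto simp: mult_ac intro!: bexI[of _ z'])
qed

lemma C_contains_N_div_M:
  assumes "x \<in> X" "\<And>i. i < s \<Longrightarrow> \<alpha> i \<in> X" "\<And>i. i < s \<Longrightarrow> \<beta> i \<in> X"
  shows "\<exists>z\<in>C. [N s \<alpha> \<beta> x e = M s \<alpha> \<beta> x e * z] (mod int p)"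
  using assms(2,3)
proof (induction s)
  case 0
  then show ?case using assms(1) X u_cong by (auto simp: N_def M_def)
next
  case (Suc s)
  then obtain z where z: "z \<in> C" "[N s \<alpha> \<beta> x e = M s \<alpha> \<beta> x e * z] (mod int p)" by auto
  obtain z' where z': "z' \<in> C"
      "[(u (\<alpha> s) * v (\<beta> s)) ^ (2 * e s) * z = (v (\<alpha> s) * u (\<beta> s)) ^ (2 * e s) * z'] (mod int p)"
    using C_contains_power_quotient[of "\<alpha> s" "\<beta> s" z "2 * e s"] Suc.prems z(1) by auto
  have "[N s \<alpha> \<beta> x e * (u (\<alpha> s) * v (\<beta> s)) ^ (2 * e s) =
      (M s \<alpha> \<beta> x e * z) * (u (\<alpha> s) * v (\<beta> s)) ^ (2 * e s)] (mod int p)"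
    by (intro cong_mult z cong_refl)
  also have "(M s \<alpha> \<beta> x e * z) * (u (\<alpha> s) * v (\<beta> s)) ^ (2 * e s) =
      M s \<alpha> \<beta> x e * ((u (\<alpha> s) * v (\<beta> s)) ^ (2 * e s) * z)"
    by (simp add: mult_ac)
  also have "[\<dots> = M s \<alpha> \<beta> x e * ((v (\<alpha> s) * u (\<beta> s)) ^ (2 * e s) * z')] (mod int p)"
    by (intro cong_mult z' cong_refl)
  finally show ?case using z'(1)
    by (auto simp: N_def M_def mult_ac intro!: bexI[of _ z'])
qed

text \<open>Each \<open>f i\<close> is a product of two numbers of size at most \<open>k\<close>,
  and the exponents \<open>2 * e i\<close> add up to at most \<open>2 * r\<close>: this gives
  \<open>4 * r\<close> factors \<open>k\<close>, and \<open>y\<close> contributes one more.\<close>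

lemma abs_prod_power_le:
  fixes f :: "nat \<Rightarrow> int"
  assumes "\<bar>y\<bar> \<le> int k" "\<And>i. i < s \<Longrightarrow> \<bar>f i\<bar> \<le> int k ^ 2" "(\<Sum>i<s. e i) \<le> r"
  shows "\<bar>y * (\<Prod>i<s. f i ^ (2 * e i))\<bar> \<le> int k ^ (4 * r + 1)"
proof -
  have "\<bar>\<Prod>i<s. f i ^ (2 * e i)\<bar> = (\<Prod>i<s. \<bar>f i\<bar> ^ (2 * e i))"
    by (simp add: abs_prod power_abs)
  also have "\<dots> \<le> (\<Prod>i<s. (int k ^ 2) ^ (2 * e i))"
    using assms(2) by (intro prod_mono) (auto intro: power_mono)
  also have "\<dots> = int k ^ (4 * (\<Sum>i<s. e i))"
    by (simp add: power_mult[symmetric] power_sum[symmetric] sum_distrib_left)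
  also have "\<dots> \<le> int k ^ (4 * r)"
    using assms(3) k_pos by (intro power_increasing) auto
  finally show ?thesis unfolding abs_mult
    using mult_mono[OF assms(1), of _ "int k ^ (4 * r)"] by simp
qed

lemma abs_mult_le:
  assumes "\<bar>x\<bar> \<le> int k" "\<bar>y\<bar> \<le> int k"
  shows "\<bar>x * y\<bar> \<le> int k ^ 2"
  using mult_mono[OF assms] by (simp add: abs_mult power2_eq_square)

text \<open>Two fractions with the same residue have a cross difference divisible by
  \<open>p\<close>. Both cross products are at most \<open>k ^ (8 * r + 2)\<close> in size, too
  small for a nonzero multiple of \<open>p\<close>.\<close>

lemma fractions_eq_if_cong:
  assumes x: "x \<in> X" "x' \<in> X" and ab: "\<And>i. i < s \<Longrightarrow> \<alpha> i \<in> X" "\<And>i. i < s \<Longrightarrow> \<beta> i \<in> X"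
    and e: "(\<Sum>i<s. e i) \<le> r" "(\<Sum>i<s. e' i) \<le> r"
    and pk: "2 * k ^ (8 * r + 2) \<le> p"
    and z: "[N s \<alpha> \<beta> x e = M s \<alpha> \<beta> x e * z] (mod int p)"
      "[N s \<alpha> \<beta> x' e' = M s \<alpha> \<beta> x' e' * z] (mod int p)"
  shows "N s \<alpha> \<beta> x e * M s \<alpha> \<beta> x' e' = N s \<alpha> \<beta> x' e' * M s \<alpha> \<beta> x e"
proof -
  let ?N = "N s \<alpha> \<beta> x e" and ?M = "M s \<alpha> \<beta> x e"
    and ?N' = "N s \<alpha> \<beta> x' e'" and ?M' = "M s \<alpha> \<beta> x' e'"
  have "[?N * ?M' = (?M * z) * ?M'] (mod int p)" by (intro cong_mult z cong_refl)
  also have "(?M * z) * ?M' = (?M' * z) * ?M" by (simp add: mult_ac)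
  also have "[\<dots> = ?N' * ?M] (mod int p)" by (intro cong_mult cong_sym[OF z(2)] cong_refl)
  finally have dvd: "int p dvd ?N * ?M' - ?N' * ?M" by (simp add: cong_iff_dvd_diff)
  have abs_v: "\<bar>v y\<bar> \<le> int k" if "y \<in> X" for y using v_le[OF that] v_pos[OF that] by simp
  have bound: "\<bar>N s \<alpha> \<beta> y f\<bar> \<le> int k ^ (4 * r + 1)" "\<bar>M s \<alpha> \<beta> y f\<bar> \<le> int k ^ (4 * r + 1)"
    if "y \<in> X" "(\<Sum>i<s. f i) \<le> r" for y f
    unfolding N_def M_def atomize_conj using that ab u_le abs_v
    by (intro conjI abs_prod_power_le abs_mult_le) auto
  have prod: "\<bar>a * b\<bar> \<le> int k ^ (8 * r + 2)"
    if "\<bar>a\<bar> \<le> int k ^ (4 * r + 1)" "\<bar>b\<bar> \<le> int k ^ (4 * r + 1)" for a b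
  proof -
    have "\<bar>a * b\<bar> \<le> int k ^ (4 * r + 1) * int k ^ (4 * r + 1)"
      using mult_mono[OF that] by (simp add: abs_mult)
    also have "\<dots> = int k ^ ((4 * r + 1) + (4 * r + 1))" by (simp only: power_add)
    finally show ?thesis by (simp add: algebra_simps)
  qed
  have "\<bar>?N * ?M' - ?N' * ?M\<bar> \<le> \<bar>?N * ?M'\<bar> + \<bar>?N' * ?M\<bar>" by (rule abs_triangle_ineq4)
  also have "\<dots> \<le> int k ^ (8 * r + 2) + int k ^ (8 * r + 2)"
    using bound x e by (intro add_mono prod) auto
  also have "\<dots> = int (2 * k ^ (8 * r + 2))" by simp
  \<comment> \<open>The inequality is strict because the left side is even and \<open>p\<close> is
    odd.\<close>
  also have "\<dots> < int p"
    using pk odd_p by (metis even_mult_iff even_numeral of_nat_less_iff order_le_less)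
  finally show ?thesis using dvd dvd_imp_le_int[of "?N * ?M' - ?N' * ?M" "int p"] by force
qed

text \<open>Taking valuations at \<open>q\<close> turns the cross-multiplied identity into a linear
  one. A collision of two translates thus makes \<open>w x - w x'\<close> a doubled combination of
  the chosen differences.\<close>

lemma exponents_eq:
  assumes x: "x \<in> X" "x' \<in> X" and ab: "\<And>i. i < s \<Longrightarrow> \<alpha> i \<in> X" "\<And>i. i < s \<Longrightarrow> \<beta> i \<in> X"
    and eq: "N s \<alpha> \<beta> x e * M s \<alpha> \<beta> x' e' = N s \<alpha> \<beta> x' e' * M s \<alpha> \<beta> x e"
  shows "w x q - w x' q = (\<Sum>i<s. 2 * (int (e' i) - int (e i)) * (w (\<alpha> i) q - w (\<beta> i) q))"
proof (cases "prime q")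
  case False
  then show ?thesis by (simp add: exponent_vector_def)
next
  case True
  then have q: "prime (int q)" and qe: "prime_elem (int q)" by simp_all
  have nz: "u y \<noteq> 0" "v y \<noteq> 0" if "y \<in> X" for y using u_nonzero v_pos[of y] that by auto
  have nzN: "N s \<alpha> \<beta> y f \<noteq> 0" "M s \<alpha> \<beta> y f \<noteq> 0" if "y \<in> X" for y f
    using nz that ab by (simp_all add: N_def M_def)
  let ?m = "multiplicity (int q)"
  have N: "int (?m (N s \<alpha> \<beta> y f)) = int (?m (u y)) +
      (\<Sum>i<s. 2 * int (f i) * (int (?m (u (\<alpha> i))) + int (?m (v (\<beta> i)))))" if "y \<in> X" for y f
  proof -
    have "?m (N s \<alpha> \<beta> y f) = ?m (u y) + (\<Sum>i<s. 2 * f i * ?m (u (\<alpha> i) * v (\<beta> i)))"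
      unfolding N_def using nz that ab q by (intro multiplicity_prod_power) auto
    also have "(\<Sum>i<s. 2 * f i * ?m (u (\<alpha> i) * v (\<beta> i))) =
        (\<Sum>i<s. 2 * f i * (?m (u (\<alpha> i)) + ?m (v (\<beta> i))))"
      using nz ab qe by (intro sum.cong) (auto simp: prime_elem_multiplicity_mult_distrib)
    finally show ?thesis by simp
  qed
  have M: "int (?m (M s \<alpha> \<beta> y f)) = int (?m (v y)) +
      (\<Sum>i<s. 2 * int (f i) * (int (?m (v (\<alpha> i))) + int (?m (u (\<beta> i)))))" if "y \<in> X" for y f
  proof -
    have "?m (M s \<alpha> \<beta> y f) = ?m (v y) + (\<Sum>i<s. 2 * f i * ?m (v (\<alpha> i) * u (\<beta> i)))"
      unfolding M_def using nz that ab q by (intro multiplicity_prod_power) auto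
    also have "(\<Sum>i<s. 2 * f i * ?m (v (\<alpha> i) * u (\<beta> i))) =
        (\<Sum>i<s. 2 * f i * (?m (v (\<alpha> i)) + ?m (u (\<beta> i))))"
      using nz ab qe by (intro sum.cong) (auto simp: prime_elem_multiplicity_mult_distrib)
    finally show ?thesis by simp
  qed
  have "int (?m (N s \<alpha> \<beta> x e)) + int (?m (M s \<alpha> \<beta> x' e')) =
      int (?m (N s \<alpha> \<beta> x' e')) + int (?m (M s \<alpha> \<beta> x e))"
    using arg_cong[OF eq, of ?m] nzN x qe
    by (simp add: prime_elem_multiplicity_mult_distrib flip: of_nat_add)
  then show ?thesis using True unfolding N[OF x(1)] N[OF x(2)] M[OF x(1)] M[OF x(2)]
    by (simp add: exponent_vector_def algebra_simps sum.distrib sum_subtractf)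
qed

text \<open>The pairs of an element of \<open>X\<close> and an exponent tuple of sum at most
  \<open>r\<close> inject into \<open>C\<close> through the residue of \<open>N / M\<close>: a
  common residue forces equal fractions, independence then forces equal tuples, and cancelling
  leaves equal elements.\<close>

lemma binomial_mult_card_le:
  assumes ab: "\<And>i. i < s \<Longrightarrow> \<alpha> i \<in> X" "\<And>i. i < s \<Longrightarrow> \<beta> i \<in> X"
    and pk: "2 * k ^ (8 * r + 2) \<le> p"
    and indep: "\<And>x x' c i. x \<in> X \<Longrightarrow> x' \<in> X \<Longrightarrow>
      (\<And>q. w x q - w x' q = (\<Sum>i<s. 2 * c i * (w (\<alpha> i) q - w (\<beta> i) q))) \<Longrightarrow> i < s \<Longrightarrow> c i = 0"
  shows "((r + s) choose s) * card X \<le> card C"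
proof -
  \<comment> \<open>The extra last entry is a slack variable: the first \<open>s\<close> entries
    range over all tuples of sum at most \<open>r\<close>, and stars and bars gives the
    count.\<close>
  let ?L = "{l :: nat list. length l = s + 1 \<and> sum_list l = r}"
  have card_L: "card ?L = (r + s) choose s"
    using card_length_sum_list[of "s + 1" r] binomial_symmetric[of r "r + s"] by simp
  have sum_le: "(\<Sum>i<s. l ! i) \<le> r" if "l \<in> ?L" for l
  proof -
    have "(\<Sum>i<Suc s. l ! i) = r" using that
      by (auto simp: sum_list_sum_nth atLeast0LessThan simp del: sum.lessThan_Suc)
    then show ?thesis by simp
  qed
  define F where "F = (\<lambda>(x, l). SOME z. z \<in> C \<and>
    [N s \<alpha> \<beta> x ((!) l) = M s \<alpha> \<beta> x ((!) l) * z] (mod int p))"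
  have F: "F (x, l) \<in> C" "[N s \<alpha> \<beta> x ((!) l) = M s \<alpha> \<beta> x ((!) l) * F (x, l)] (mod int p)"
    if "x \<in> X" for x l
  proof -
    have "\<exists>z. z \<in> C \<and> [N s \<alpha> \<beta> x ((!) l) = M s \<alpha> \<beta> x ((!) l) * z] (mod int p)"
      using C_contains_N_div_M[of x s \<alpha> \<beta> "(!) l", OF that ab] by blast
    from someI_ex[OF this]
    show "F (x, l) \<in> C" "[N s \<alpha> \<beta> x ((!) l) = M s \<alpha> \<beta> x ((!) l) * F (x, l)] (mod int p)"
      by (simp_all add: F_def)
  qed
  have "inj_on F (X \<times> ?L)"
  proof (rule inj_onI, clarify)
    fix x x' l l'
    assume x: "x \<in> X" "x' \<in> X" and eqF: "F (x, l) = F (x', l')"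
      and l: "length l = s + 1" "r = sum_list l" and l': "length l' = s + 1" "sum_list l' = sum_list l"
    have L: "l \<in> ?L" "l' \<in> ?L" using l l' by auto
    have eq: "N s \<alpha> \<beta> x ((!) l) * M s \<alpha> \<beta> x' ((!) l') = N s \<alpha> \<beta> x' ((!) l') * M s \<alpha> \<beta> x ((!) l)"
    proof (rule fractions_eq_if_cong)
      show "[N s \<alpha> \<beta> x ((!) l) = M s \<alpha> \<beta> x ((!) l) * F (x', l')] (mod int p)"
        using F(2)[OF x(1), of l] by (simp add: eqF)
      show "[N s \<alpha> \<beta> x' ((!) l') = M s \<alpha> \<beta> x' ((!) l') * F (x', l')] (mod int p)"
        by (rule F(2)[OF x(2)])
    qed (fact x ab pk sum_le[OF L(1)] sum_le[OF L(2)])+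
    have "int (l' ! i) - int (l ! i) = 0" if "i < s" for i
    proof (rule indep[where c = "\<lambda>i. int (l' ! i) - int (l ! i)", OF x _ that])
      fix q
      show "w x q - w x' q =
          (\<Sum>i<s. 2 * (int (l' ! i) - int (l ! i)) * (w (\<alpha> i) q - w (\<beta> i) q))"
        by (rule exponents_eq[OF x _ _ eq]) (fact ab)+
    qed
    then have nth: "l ! i = l' ! i" if "i < s" for i using that by simp
    moreover have "l ! s = l' ! s"
    proof -
      have "(\<Sum>i<Suc s. l ! i) = (\<Sum>i<Suc s. l' ! i)"
        using l l' by (simp add: sum_list_sum_nth atLeast0LessThan del: sum.lessThan_Suc)
      then show ?thesis using nth by simp
    qed
    ultimately have "l = l'" using l l' by (intro nth_equalityI) (auto simp: less_Suc_eq)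
    \<comment> \<open>With equal tuples, \<open>A\<close> is the nonzero common factor of both sides
      of \<open>eq\<close>.\<close>
    define A where "A = (\<Prod>i<s. (u (\<alpha> i) * v (\<beta> i)) ^ (2 * l ! i)) * (\<Prod>i<s. (v (\<alpha> i) * u (\<beta> i)) ^ (2 * l ! i))"
    have "v (\<alpha> i) \<noteq> 0" "v (\<beta> i) \<noteq> 0" if "i < s" for i
      using v_pos[OF ab(1)[OF that]] v_pos[OF ab(2)[OF that]] by simp_all
    then have "A \<noteq> 0" using ab u_nonzero by (simp add: A_def)
    moreover have "A * (u x * v x') = A * (u x' * v x)"
      using eq \<open>l = l'\<close> by (simp add: A_def N_def M_def mult_ac)
    ultimately have "u x * v x' = u x' * v x" by simp
    then have "x = x'" by (rule eq_if_fractions_eq[OF x])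
    then show "x = x' \<and> l = l'" using \<open>l = l'\<close> by simp
  qed
  moreover have "F ` (X \<times> ?L) \<subseteq> C" using F(1) by blast
  ultimately have "card (X \<times> ?L) \<le> card C" using finite_C by (rule card_inj_on_le)
  then show ?thesis by (simp only: card_cartesian_product card_L mult.commute)
qed

section \<open>Counting when few primes separate the exponent vectors\<close>

text \<open>Exponents determine a nonzero rational up to sign, and as denominators are positive the
  sign is that of \<open>u x\<close>.\<close>

lemma fractions_eq_if_exponents_eq:
  assumes x: "x \<in> X" "x' \<in> X" and w: "\<And>q. w x q = w x' q" and sgn: "0 < u x \<longleftrightarrow> 0 < u x'"
  shows "x = x'"
proof -
  have nz: "u x \<noteq> 0" "u x' \<noteq> 0" "v x \<noteq> 0" "v x' \<noteq> 0"
    using u_nonzero v_pos[of x] v_pos[of x'] x by auto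
  have "normalize (u x * v x') = normalize (u x' * v x)"
  proof (rule multiplicity_eq_imp_eq)
    fix q :: int assume q: "prime q"
    then obtain q' where q': "q = int q'" using zero_le_imp_eq_int[OF prime_ge_0_int] by blast
    then have "prime q'" using q by simp
    then have "int (multiplicity q (u x)) - int (multiplicity q (v x)) =
        int (multiplicity q (u x')) - int (multiplicity q (v x'))"
      using w[of q'] q' by (simp add: exponent_vector_def)
    then show "multiplicity q (u x * v x') = multiplicity q (u x' * v x)"
      using prime_imp_prime_elem[OF q] nz by (simp add: prime_elem_multiplicity_mult_distrib)
  qed (use nz in auto)
  then have eq: "\<bar>u x\<bar> * v x' = \<bar>u x'\<bar> * v x"
    using v_pos[OF x(1)] v_pos[OF x(2)] by (simp add: abs_mult)
  have "u x * v x' = u x' * v x"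
  proof (cases "0 < u x")
    case True
    then show ?thesis using eq sgn by simp
  next
    case False
    then have "\<bar>u x\<bar> = - u x" "\<bar>u x'\<bar> = - u x'" using sgn by simp_all
    then show ?thesis using eq by simp
  qed
  then show ?thesis by (rule eq_if_fractions_eq[OF x])
qed

text \<open>Relative to a fixed \<open>y\<close>, encode \<open>x\<close> by the sign of
  \<open>u x\<close>, the set \<open>I x\<close> of primes of \<open>Q\<close> with positive
  relative exponent, and the \<open>Q\<close>-parts \<open>n x\<close> and \<open>m x\<close> of
  numerator and denominator. The sign accounts for the factor 2.\<close>

lemma card_le_Phi_tilde:
  assumes Q: "finite Q" "\<And>q. q \<in> Q \<Longrightarrow> prime q"
    and sep: "\<And>x x'. x \<in> X \<Longrightarrow> x' \<in> X \<Longrightarrow> (\<And>q. q \<in> Q \<Longrightarrow> w x q = w x' q) \<Longrightarrow> (\<And>q. w x q = w x' q)"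
  shows "card X \<le> 2 * Phi_tilde ((real k)\<^sup>2) (card Q)"
proof (cases "X = {}")
  case False
  then obtain y where y: "y \<in> X" by auto
  have nz: "u x \<noteq> 0" "v x \<noteq> 0" if "x \<in> X" for x
    using u_nonzero v_pos[of x] that by auto
  let ?S = "smooth_over (k ^ 2)"
  \<comment> \<open>Such a product divides \<open>T\<close> and so is at most \<open>k ^ 2\<close>.
    It is applied to \<open>T = u x * v y\<close> and \<open>T = v x * u y\<close>, where
    cancellation in \<open>d x q\<close> can only lower the exponents.\<close>
  have smooth: "(\<Prod>q\<in>I. q ^ f q) \<in> ?S I"
    if I: "I \<subseteq> Q" and T: "T \<noteq> 0" "\<bar>T\<bar> \<le> int k ^ 2"
      and f: "\<And>q. q \<in> I \<Longrightarrow> f q \<le> multiplicity (int q) T" for I f T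
  proof -
    have fin: "finite I" using I Q(1) by (rule finite_subset)
    have pr: "prime q" if "q \<in> I" for q using I Q(2) that by blast
    let ?n = "\<Prod>q\<in>I. q ^ f q"
    have "q ^ f q dvd nat \<bar>T\<bar>" if "q \<in> I" for q
      using multiplicity_dvd'[OF f[OF that]] by (simp add: nat_abs_dvd_iff flip: of_nat_power)
    then have "?n dvd nat \<bar>T\<bar>" using fin pr by (intro prod_prime_power_dvd)
    then have "?n \<le> nat \<bar>T\<bar>" using T by (intro dvd_imp_le) auto
    also have "\<dots> \<le> k ^ 2" using T(2) by (simp add: nat_le_iff)
    finally have "?n \<le> k ^ 2" .
    moreover have "?n > 0" using pr by (intro prod_pos) (auto simp: prime_gt_0_nat)
    moreover have "prime_factors ?n \<subseteq> I"
    proof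
      fix l assume "l \<in> prime_factors ?n"
      then have "prime l" "l dvd ?n" by auto
      then obtain q where "q \<in> I" "l dvd q ^ f q" using fin by (auto simp: prime_dvd_prod_iff)
      then show "l \<in> I" using \<open>prime l\<close> pr primes_dvd_imp_eq prime_dvd_power by metis
    qed
    ultimately show ?thesis by (simp add: smooth_over_def)
  qed
  define d where "d x q = w x q - w y q" for x q
  define I where "I x = {q \<in> Q. 0 < d x q}" for x
  define n where "n x = (\<Prod>q\<in>I x. q ^ nat (d x q))" for x
  define m where "m x = (\<Prod>q\<in>Q - I x. q ^ nat (- d x q))" for x
  have IQ: "I x \<subseteq> Q" for x by (auto simp: I_def)
  have n: "n x \<in> ?S (I x)" if x: "x \<in> X" for x
    unfolding n_def
  proof (rule smooth[of _ "u x * v y"])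
    show "\<bar>u x * v y\<bar> \<le> int k ^ 2" using u_le[OF x] v_le[OF y] v_pos[OF y] by (intro abs_mult_le) auto
    fix q assume "q \<in> I x"
    then have "prime q" using Q by (auto simp: I_def)
    then show "nat (d x q) \<le> multiplicity (int q) (u x * v y)"
      using nz[OF x] nz[OF y]
      by (simp add: d_def exponent_vector_def prime_elem_multiplicity_mult_distrib)
  qed (use nz x y IQ in auto)
  have m: "m x \<in> ?S (Q - I x)" if x: "x \<in> X" for x
    unfolding m_def
  proof (rule smooth[of _ "v x * u y"])
    show "\<bar>v x * u y\<bar> \<le> int k ^ 2" using u_le[OF y] v_le[OF x] v_pos[OF x] by (intro abs_mult_le) auto
    fix q assume "q \<in> Q - I x"
    then have "prime q" using Q by auto
    then show "nat (- d x q) \<le> multiplicity (int q) (v x * u y)"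
      using nz[OF x] nz[OF y]
      by (simp add: d_def exponent_vector_def prime_elem_multiplicity_mult_distrib)
  qed (use nz x y in auto)
  let ?T = "(UNIV :: bool set) \<times> (SIGMA J:Pow Q. ?S J \<times> ?S (Q - J))"
  define F where "F x = (0 < u x, I x, n x, m x)" for x
  have inj: "inj_on F X"
  proof (rule inj_onI)
    fix x x' assume x: "x \<in> X" "x' \<in> X" and eq: "F x = F x'"
    have "w x q = w x' q" if q: "q \<in> Q" for q
    proof -
      have pr: "prime q" using Q q by auto
      have mult_n: "multiplicity q (n z) = (if q \<in> I z then nat (d z q) else 0)" for z
        unfolding n_def using Q(2) IQ[of z]
        by (intro multiplicity_prod_prime_powers[OF finite_subset[OF IQ Q(1)] _ pr]) blast
      have mult_m: "multiplicity q (m z) = (if q \<in> Q - I z then nat (- d z q) else 0)" for z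
        unfolding m_def using Q(2)
        by (intro multiplicity_prod_prime_powers[OF finite_Diff[OF Q(1)] _ pr]) blast
      have eqs: "n x = n x'" "m x = m x'" "I x = I x'" using eq by (simp_all add: F_def)
      have "d x q = d x' q"
      proof (cases "q \<in> I x")
        case True
        then have "q \<in> I x'" by (simp add: eqs)
        then show ?thesis using mult_n[of x] mult_n[of x'] True eqs(1) by (simp add: I_def)
      next
        case False
        then have "q \<notin> I x'" by (simp add: eqs)
        then show ?thesis using mult_m[of x] mult_m[of x'] False eqs(2) q by (simp add: I_def)
      qed
      then show ?thesis by (simp add: d_def)
    qed
    then have "w x q = w x' q" for q using sep[OF x] by blast
    then show "x = x'" by (rule fractions_eq_if_exponents_eq[OF x]) (use eq in \<open>simp add: F_def\<close>)
  qed
  have "F ` X \<subseteq> ?T" using n m IQ by (auto simp: F_def)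
  moreover have "finite ?T"
    using Q(1) by (intro finite_cartesian_product finite_SigmaI) simp_all
  ultimately have "card X \<le> card ?T" by (rule card_inj_on_le[OF inj])
  also have "\<dots> = 2 * (\<Sum>J\<in>Pow Q. card (?S J) * card (?S (Q - J)))"
    using Q(1) by (simp add: card_cartesian_product card_SigmaI)
  also have "(\<Sum>J\<in>Pow Q. card (?S J) * card (?S (Q - J))) \<le>
      (\<Sum>J\<in>Pow Q. Psi_prime ((real k)\<^sup>2) (card J) * Psi_prime ((real k)\<^sup>2) (card Q - card J))"
  proof (intro sum_mono mult_le_mono)
    fix J assume J: "J \<in> Pow Q"
    then have fin: "finite J" using Q(1) by (auto intro: finite_subset)
    show "card (?S J) \<le> Psi_prime ((real k)\<^sup>2) (card J)"
      using card_smooth_over_le_Psi_prime[of J "k ^ 2"] fin J Q by auto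
    have "card (Q - J) = card Q - card J" using J fin by (simp add: card_Diff_subset)
    then show "card (?S (Q - J)) \<le> Psi_prime ((real k)\<^sup>2) (card Q - card J)"
      using card_smooth_over_le_Psi_prime[of "Q - J" "k ^ 2"] Q by auto
  qed
  \<comment> \<open>The summand depends on \<open>J\<close> only through its size, so grouping the
    subsets by size produces the binomial coefficients of \<open>Phi_tilde\<close>.\<close>
  also have "(\<Sum>J\<in>Pow Q. Psi_prime ((real k)\<^sup>2) (card J) * Psi_prime ((real k)\<^sup>2) (card Q - card J)) =
      Phi_tilde ((real k)\<^sup>2) (card Q)"
    unfolding Phi_tilde_def using sum_Pow_card[OF Q(1), of "\<lambda>i. Psi_prime ((real k)\<^sup>2) i * Psi_prime ((real k)\<^sup>2) (card Q - i)"]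
    by (simp add: mult.assoc)
  finally show ?thesis by simp
qed simp

section \<open>The two outcomes of the greedy choice\<close>

lemma card_le_or_binomial_mult_card_le:
  assumes pk: "2 * k ^ (8 * r + 2) \<le> p"
  shows "card X \<le> 2 * Phi_tilde ((real k)\<^sup>2) (s - 1) \<or> ((r + s) choose s) * card X \<le> card C"
proof -
  define D where "D = (\<lambda>(x, x') q. w x q - w x' q) ` (X \<times> X)"
  have DI: "(\<lambda>q. w x q - w x' q) \<in> D" if "x \<in> X" "x' \<in> X" for x x'
    unfolding D_def using that by (intro image_eqI[of _ _ "(x, x')"]) simp_all
  have DE: "\<exists>x\<in>X. \<exists>x'\<in>X. d = (\<lambda>q. w x q - w x' q)" if "d \<in> D" for d
    using that unfolding D_def by auto
  have "finite D" using finite_X by (simp add: D_def)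
  from greedy_flag[OF this, of s] show ?thesis
  proof (elim disjE exE, goal_cases)
    case (1 Q)
    then have Q: "finite Q" "card Q < s" "\<forall>q\<in>Q. \<exists>d\<in>D. d q \<noteq> 0"
      and zero: "\<forall>d\<in>D. (\<forall>q\<in>Q. d q = 0) \<longrightarrow> (\<forall>q. d q = 0)"
      by blast+
    have pr: "prime q" if q: "q \<in> Q" for q
    proof (rule ccontr)
      assume not_prime: "\<not> prime q"
      obtain d where d: "d \<in> D" "d q \<noteq> 0" using bspec[OF Q(3) q] by (elim bexE)
      obtain x x' where "d = (\<lambda>q. w x q - w x' q)" using DE[OF d(1)] by (elim bexE)
      then have "d q = 0" using not_prime by (simp add: exponent_vector_def)
      with d(2) show False by contradiction
    qed
    \<comment> \<open>\<open>Q\<close> may have fewer than \<open>s - 1\<close> elements. Padding it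
      with further primes preserves separation and gives exactly the index \<open>s - 1\<close>,
      without comparing values of \<open>Phi_tilde\<close>.\<close>
    have "infinite ({q. prime q} - Q)" using Q(1) primes_infinite by (rule Diff_infinite_finite)
    then obtain R where R: "R \<subseteq> {q. prime q} - Q" "finite R" "card R = s - 1 - card Q"
      using infinite_arbitrarily_large[of "{q. prime q} - Q" "s - 1 - card Q"] by blast
    have "card (Q \<union> R) = card Q + card R" using R Q(1) by (intro card_Un_disjoint) auto
    then have card: "card (Q \<union> R) = s - 1" using R(3) Q(2) by simp
    have "card X \<le> 2 * Phi_tilde ((real k)\<^sup>2) (card (Q \<union> R))"
    proof (rule card_le_Phi_tilde)
      show "finite (Q \<union> R)" using R(2) Q(1) by simp
      show "prime q" if "q \<in> Q \<union> R" for q using that pr[of q] R(1) by blast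
      fix x x' q assume x: "x \<in> X" "x' \<in> X" and eq: "\<And>q. q \<in> Q \<union> R \<Longrightarrow> w x q = w x' q"
      have "\<forall>q\<in>Q. w x q - w x' q = 0" using eq by simp
      then have "w x q - w x' q = 0" by (rule spec[OF mp[OF bspec[OF zero DI[OF x]]]])
      then show "w x q = w x' q" by simp
    qed
    then show ?case by (simp add: card)
  next
    case (2 y q)
    \<comment> \<open>Each \<open>y i\<close> is a difference of two exponent vectors; the pairs
      behind them become \<alpha> and \<beta>.\<close>
    have "\<exists>ab \<in> X \<times> X. y i = (\<lambda>q. w (fst ab) q - w (snd ab) q)" if "i \<in> {..<s}" for i
      using DE[of "y i"] 2[rule_format, of i] that by auto
    then have "\<exists>f. \<forall>i\<in>{..<s}. f i \<in> X \<times> X \<and> y i = (\<lambda>q. w (fst (f i)) q - w (snd (f i)) q)"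
      by (intro bchoice) blast
    then obtain f where f: "\<And>i. i < s \<Longrightarrow> f i \<in> X \<times> X"
      "\<And>i. i < s \<Longrightarrow> y i = (\<lambda>q. w (fst (f i)) q - w (snd (f i)) q)"
      by auto
    define \<alpha> \<beta> where "\<alpha> i = fst (f i)" and "\<beta> i = snd (f i)" for i
    have ab: "\<alpha> i \<in> X" "\<beta> i \<in> X" "y i = (\<lambda>q. w (\<alpha> i) q - w (\<beta> i) q)" if "i < s" for i
      using f(1)[OF that] f(2)[OF that] by (auto simp: \<alpha>_def \<beta>_def)
    have "((r + s) choose s) * card X \<le> card C"
    proof (rule binomial_mult_card_le[OF _ _ pk])
      fix x x' c i
      assume x: "x \<in> X" "x' \<in> X" and i: "i < s"
        and eq: "\<And>q. w x q - w x' q = (\<Sum>i<s. 2 * c i * (w (\<alpha> i) q - w (\<beta> i) q))"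
      have "(\<lambda>q. w x q - w x' q) t = (\<Sum>i<s. 2 * c i * y i t)" for t
        using eq[of t] ab(3) by simp
      then show "c i = 0"
        by (rule greedy_flag_doubled_combination[where c = c, OF 2 DI[OF x] _ i])
    qed (fact ab)+
    then show ?case by simp
  qed
qed

end

section \<open>Heights, the size of \<open>r\<close>, and cosets\<close>

lemma ex_fraction_of_rational_height:
  assumes "rational_height p x \<le> k"
  shows "\<exists>u v. [u = v * x] (mod int p) \<and> \<bar>u\<bar> \<le> int k \<and> 0 < v \<and> v \<le> int k"
proof -
  let ?P = "\<lambda>h. \<exists>(a::int) (b::nat). b \<ge> 1 \<and> [a = int b * x] (mod int p) \<and> h = max (nat \<bar>a\<bar>) b"
  have "?P (max (nat \<bar>x\<bar>) 1)" by (intro exI[of _ x] exI[of _ 1]) simp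
  then have "?P (rational_height p x)" unfolding rational_height_def by (rule LeastI)
  then obtain a b where ab: "b \<ge> 1" "[a = int b * x] (mod int p)"
    "rational_height p x = max (nat \<bar>a\<bar>) b" by blast
  then have "nat \<bar>a\<bar> \<le> k" "b \<le> k" using assms by auto
  then show ?thesis using ab(1,2) by (intro exI[of _ a] exI[of _ "int b"]) auto
qed

text \<open>Exponentiating \<open>(r + 1/4) * 8 * ln k \<le> ln (p / 2)\<close> gives the claim; the
  summand 1/4 in \<open>r2\<close> pays for the 2 in the exponent, and \<open>p / 2\<close> for the
  factor 2.\<close>

lemma power_le_if_le_r2:
  assumes "p > 2" "k > 1" "int r \<le> r2 p k"
  shows "2 * k ^ (8 * r + 2) \<le> p"
proof -
  have lnk: "ln (real k) > 0" using assms by simp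
  have "real r \<le> ln (real p / 2) / (8 * ln (real k)) - 1 / 4"
    using assms(3) by (simp add: r2_def le_floor_iff)
  then have "(real r + 1 / 4) * (8 * ln (real k)) \<le> ln (real p / 2)"
    using lnk by (simp add: pos_le_divide_eq[symmetric])
  then have "real (8 * r + 2) * ln (real k) \<le> ln (real p / 2)" by (simp add: algebra_simps)
  then have "ln (real k ^ (8 * r + 2)) \<le> ln (real p / 2)"
    using assms by (subst ln_realpow) auto
  then have "real k ^ (8 * r + 2) \<le> real p / 2" using assms by (subst (asm) ln_le_cancel_iff) auto
  then have "real (2 * k ^ (8 * r + 2)) \<le> real p" by simp
  then show ?thesis by (simp only: of_nat_le_iff)
qed

lemma r2_ge:
  assumes "p > 2" "k > 1"
  shows "r2 p k \<ge> -1"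
proof -
  have "0 \<le> ln (real p / 2) / (8 * ln (real k))" using assms by simp
  then show ?thesis unfolding r2_def by (simp add: le_floor_iff)
qed

lemma subgroup_coset:
  assumes p: "prime p" "t > 0" "t dvd p - 1" "a \<in> carrier (Fp_star p)"
  defines "C \<equiv> a <#\<^bsub>Fp_star p\<^esub> subgroup_of_order p t"
  shows coset_subset: "C \<subseteq> {0<..<int p}"
    and card_coset: "card C = t"
    and coset_quotient: "\<And>x y z. x \<in> C \<Longrightarrow> y \<in> C \<Longrightarrow> z \<in> C \<Longrightarrow> \<exists>c\<in>C. [c * z = x * y] (mod int p)"
proof -
  let ?G = "subgroup_of_order p t" and ?R = "residue_ring (int p)"
  have p1: "p > 1" using p(1) prime_gt_1_nat by blast
  have "residues_prime p" using p(1) by unfold_locales simp_all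
  then interpret F: Ring.field ?R by (rule residues_prime.is_field)
  interpret M: Group.group "Fp_star p" by (rule F.field_mult_group)
  have G: "subgroup ?G (Fp_star p)" "card ?G = t"
    using theI'[OF ex1_subgroup_of_order[OF p(1,3,2)]] by (simp_all add: subgroup_of_order_def)
  have car: "carrier (Fp_star p) = {0<..<int p}"
    by (auto simp: residue_ring_def)
  have mult: "x \<otimes>\<^bsub>Fp_star p\<^esub> y = x * y mod int p" for x y
    by (simp add: residue_ring_def)
  have GM: "g \<in> carrier (Fp_star p)" if "g \<in> ?G" for g using subgroup.mem_carrier[OF G(1) that] .
  have C: "C = (\<lambda>h. a \<otimes>\<^bsub>Fp_star p\<^esub> h) ` ?G" by (auto simp: C_def l_coset_def)
  have CM: "C \<subseteq> carrier (Fp_star p)" unfolding C using GM p(4) M.m_closed by blast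
  then show "C \<subseteq> {0<..<int p}" using car by simp
  have "inj_on (\<lambda>h. a \<otimes>\<^bsub>Fp_star p\<^esub> h) ?G"
    using M.inj_on_cmult[OF p(4)] by (rule inj_on_subset) (use GM in blast)
  then show "card C = t" unfolding C using G(2) by (simp only: card_image)
  fix x y z assume "x \<in> C" "y \<in> C" "z \<in> C"
  then obtain g h l where g: "g \<in> ?G" "h \<in> ?G" "l \<in> ?G"
    and x: "x = a \<otimes>\<^bsub>Fp_star p\<^esub> g" "y = a \<otimes>\<^bsub>Fp_star p\<^esub> h" "z = a \<otimes>\<^bsub>Fp_star p\<^esub> l"
    unfolding C by blast
  \<comment> \<open>The quotient of \<open>a * g * a * h\<close> by \<open>a * l\<close> is
    \<open>a * (g * h / l)\<close>, again in the coset.\<close>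
  define c where "c = a \<otimes>\<^bsub>Fp_star p\<^esub> (g \<otimes>\<^bsub>Fp_star p\<^esub> h \<otimes>\<^bsub>Fp_star p\<^esub> inv\<^bsub>Fp_star p\<^esub> l)"
  let ?i = "inv\<^bsub>Fp_star p\<^esub> l"
  have "c \<in> C" unfolding C c_def
    using g G(1) by (intro imageI subgroup.m_closed subgroup.m_inv_closed)
  moreover have "[c * z = x * y] (mod int p)"
  proof -
    have one: "[?i * l = 1] (mod int p)"
      using M.l_inv[OF GM[OF g(3)]] p1 unfolding mult by (simp add: residue_ring_def cong_def)
    have c: "[c = a * (g * h * ?i)] (mod int p)"
      unfolding c_def mult by (simp add: cong_def mod_simps)
    have "[c * z = (a * (g * h * ?i)) * (a * l)] (mod int p)"
      unfolding x mult by (intro cong_mult c) (simp add: cong_def)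
    also have "(a * (g * h * ?i)) * (a * l) = (a * g * (a * h)) * (?i * l)" by (simp only: mult_ac)
    also have "[\<dots> = (a * g * (a * h)) * 1] (mod int p)" by (intro cong_mult one cong_refl)
    also have "[(a * g * (a * h)) * 1 = x * y] (mod int p)"
      unfolding x mult by (simp add: cong_def mod_simps)
    finally show ?thesis .
  qed
  ultimately show "\<exists>c\<in>C. [c * z = x * y] (mod int p)" by blast
qed

section \<open>Specialisation to the coset \<open>aG\<close>, with the degenerate case
  \<open>r = -1\<close>\<close>

theorem theorem1p7:
  fixes p t k s :: nat and a :: int
  assumes "prime p" and "p > 2"
    and "t > 0" and "t dvd p - 1"
    and "k > 1"
    and "s \<ge> 1"
    and "a \<in> carrier (Fp_star p)"
  shows "ereal (real (card (V p k t a)))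
    \<le> max (ereal (real (2 * Phi_tilde ((real k)\<^sup>2) (s - 1))))
          (inverse_binomial (r2 p k) s * ereal (real t))"
proof (cases "r2 p k = -1")
  case True
  \<comment> \<open>For \<open>s \<ge> 1\<close> the coefficient of \<open>s - 1\<close> over
    \<open>s\<close> is 0, so its extended-real inverse is infinite; as \<open>t > 0\<close>, the
    bound is trivial.\<close>
  have "of_int (-1 + int s) = (of_nat (s - 1) :: real)" using assms(6) by (simp add: of_nat_diff)
  then have "(of_int (-1 + int s) gchoose s :: real) = real ((s - 1) choose s)"
    by (simp only: binomial_gbinomial)
  then have "inverse_binomial (r2 p k) s = \<infinity>"
    using True assms(6) by (simp add: inverse_binomial_def)
  then show ?thesis using assms(3) by simp
next
  case False
  then obtain r where r: "r2 p k = int r"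
    using r2_ge[OF assms(2,5)] zero_le_imp_eq_int[of "r2 p k"] by fastforce
  have pk: "2 * k ^ (8 * r + 2) \<le> p" using power_le_if_le_r2[OF assms(2,5)] r by simp
  let ?C = "a <#\<^bsub>Fp_star p\<^esub> subgroup_of_order p t" and ?V = "V p k t a"
  have "\<forall>x\<in>?V. \<exists>u v. [u = v * x] (mod int p) \<and> \<bar>u\<bar> \<le> int k \<and> 0 < v \<and> v \<le> int k"
    unfolding V_def using ex_fraction_of_rational_height by blast
  then obtain u v where uv: "\<And>x. x \<in> ?V \<Longrightarrow>
      [u x = v x * x] (mod int p) \<and> \<bar>u x\<bar> \<le> int k \<and> 0 < v x \<and> v x \<le> int k"
    by metis
  have "k ^ 1 \<le> k ^ (8 * r + 2)" using assms(5) by (intro power_increasing) auto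
  then have "k < p" using pk assms(5) unfolding power_one_right by linarith
  interpret small_fractions p k ?C ?V u v
  proof
    show "prime p" by fact
    show "odd p" using assms(1,2) prime_odd_nat by blast
    show "0 < k" "k < p" using assms(5) \<open>k < p\<close> by simp_all
    show "?C \<subseteq> {0<..<int p}" by (rule coset_subset) fact+
    show "\<exists>c\<in>?C. [c * z = x * y] (mod int p)" if "x \<in> ?C" "y \<in> ?C" "z \<in> ?C" for x y z
      by (rule coset_quotient) fact+
    show "?V \<subseteq> ?C" by (auto simp: V_def)
  qed (use uv in auto)
  have card: "card ?C = t" by (rule card_coset) fact+
  \<comment> \<open>For \<open>r \<ge> 0\<close> the coefficient is an ordinary positive integer, so
    the bound reduces to division of reals.\<close>
  have "inverse_binomial (r2 p k) s = ereal (1 / real ((r + s) choose s))"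
  proof -
    have "(of_int (int r + int s) gchoose s :: real) = real ((r + s) choose s)"
      by (simp add: binomial_gbinomial)
    then show ?thesis by (simp add: inverse_binomial_def r divide_inverse)
  qed
  then have rhs: "inverse_binomial (r2 p k) s * ereal (real t) = ereal (real t / real ((r + s) choose s))"
    by simp
  show ?thesis
  proof (cases "card ?V \<le> 2 * Phi_tilde ((real k)\<^sup>2) (s - 1)")
    case True
    then show ?thesis by (intro max.coboundedI1) (simp only: ereal_less_eq of_nat_le_iff)
  next
    case False
    then have "((r + s) choose s) * card ?V \<le> t"
      using card_le_or_binomial_mult_card_le[OF pk, of s] card by simp
    then have "real ((r + s) choose s) * real (card ?V) \<le> real t" by (simp flip: of_nat_mult)
    then have "real (card ?V) \<le> real t / real ((r + s) choose s)"
      by (simp add: pos_le_divide_eq mult.commute)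
    then show ?thesis unfolding rhs by (intro max.coboundedI2) simp
  qed
qed

end
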